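(* Fix $\lambda\in\mathbb{R}\setminus\{0\}$. Let $\phi_n$ be the $n$-th order $B$-spline on the Heisenberg group $\mathbb{H}$ and let $K^\lambda_{\phi_n^\lambda}$ be the kernel of the integral operator $\widehat{\phi}_n(\lambda)$ on $L^2(\mathbb{R})$. Then $$K_{\phi_1^\lambda}^\lambda(\xi,\eta)=\sqrt{2}\,e^{\pi i\lambda}\operatorname{sinc}(\lambda)\,e^{\pi i\lambda(\xi+\eta)}\operatorname{sinc}(\lambda(\xi+\eta))\,\chi_{[0,1]}(\eta-\xi),\qquad \xi,\eta\in\mathbb{R},$$ and for every integer $n\geq 2$, $$K_{\phi_n^\lambda}^\lambda(\xi,\eta)=\sqrt{2}\,e^{\pi i\lambda}\operatorname{sinc}(\lambda)\,e^{2\pi i\lambda\eta}\int_0^1e^{-\pi i\lambda w}\operatorname{sinc}(\lambda(2\eta-w))\,K_{\phi_{n-1}^\lambda}^\lambda(\xi,\eta-w)\,dw,\qquad \xi,\eta\in\mathbb{R}.$$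
   Context: The Heisenberg group $\mathbb{H}$ is $\mathbb{R}^3$ with the group law $(x,y,t)(x',y',t')=(x+x',\,y+y',\,t+t'+\tfrac12(x'y-y'x))$, so that $(x,y,t)^{-1}=(-x,-y,-t)$; Haar measure is Lebesgue measure $dx\,dy\,dt$ on $\mathbb{R}^3$. For $f,g\in L^1(\mathbb{H})$, the convolution is $(f*g)(x,y,t)=\int_{\mathbb{H}}f\big((x,y,t)(u,v,s)^{-1}\big)g(u,v,s)\,du\,dv\,ds$. The $B$-splines on $\mathbb{H}$ are $\phi_1=\frac{1}{\sqrt2}\chi_{[0,2]\times[0,1]\times[0,1]}$ and $\phi_{n+1}=\phi_n*\phi_1$ for $n\ge1$ (so $\phi_n$ is the $n$-fold convolution of $\phi_1$). For $\lambda\in\mathbb{R}\setminus\{0\}$, the Schrödinger representation $\pi_\lambda$ of $\mathbb{H}$ on $L^2(\mathbb{R})$ is $\pi_\lambda(x,y,t)\varphi(\xi)=e^{2\pi i\lambda t}e^{2\pi i\lambda(x\xi+\frac12xy)}\varphi(\xi+y)$. The group Fourier transform of $f\in L^1(\mathbb{H})$ is the operator-valued function $\widehat f(\lambda)=\int_{\mathbb{H}}f(x,y,t)\,\pi_\lambda(x,y,t)\,dx\,dy\,dt$ (Bochner integral, acting on $L^2(\mathbb{R})$). Put $f^\lambda(x,y)=\int_{\mathbb{R}}f(x,y,t)e^{2\pi i\lambda t}\,dt$. Then $\widehat f(\lambda)$ is the integral operator $\varphi\mapsto\int_{\mathbb{R}}K^\lambda_{f^\lambda}(\cdot,\eta)\varphi(\eta)\,d\eta$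 with kernel $K^\lambda_{f^\lambda}(\xi,\eta)=\int_{\mathbb{R}}f^\lambda(x,\eta-\xi)e^{\pi i\lambda x(\xi+\eta)}\,dx$. Convention: $\operatorname{sinc}z=\frac{\sin\pi z}{\pi z}$ for $z\in\mathbb{R}$, with $\operatorname{sinc}0=1$. *)

theory Defs
  imports "HOL-Analysis.Analysis"
begin

section \<open>The Heisenberg group\<close>

type_synonym heis = "real \<times> real \<times> real"

definition heis_mult :: "heis \<Rightarrow> heis \<Rightarrow> heis" where
  "heis_mult = (\<lambda>(x, y, t) (x', y', t').
     (x + x', y + y', t + t' + 1/2 * (x' * y - y' * x)))"

definition heis_inv :: "heis \<Rightarrow> heis" where
  "heis_inv = (\<lambda>(x, y, t). (- x, - y, - t))"

definition heis_conv :: "(heis \<Rightarrow> complex) \<Rightarrow> (heis \<Rightarrow> complex) \<Rightarrow> heis \<Rightarrow> complex" where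
  "heis_conv f g p = (LINT q|lborel. f (heis_mult p (heis_inv q)) * g q)"

text \<open>The splines are indexed from 1; the value at index 0 is irrelevant.\<close>

fun bspline :: "nat \<Rightarrow> heis \<Rightarrow> complex" where
  "bspline 0 = (\<lambda>_. 0)"
| "bspline (Suc 0) =
     (\<lambda>p. complex_of_real (1 / sqrt 2) * indicator ({0..2} \<times> {0..1} \<times> {0..1}) p)"
| "bspline (Suc (Suc n)) = heis_conv (bspline (Suc n)) (bspline (Suc 0))"


section \<open>The group Fourier transform and its kernel\<close>

definition schroedinger :: "real \<Rightarrow> heis \<Rightarrow> (real \<Rightarrow> complex) \<Rightarrow> real \<Rightarrow> complex" where
  "schroedinger lam = (\<lambda>(x :: real, y :: real, t :: real) \<phi> (\<xi> :: real).
     exp (2 * pi * \<i> * lam * t) * exp (2 * pi * \<i> * lam * (x * \<xi> + 1/2 * x * y)) * \<phi> (\<xi> + y))"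

text \<open>
  The library has no Banach space of square-integrable functions on the line.  The vector
  obtained by applying the Bochner integral to \<open>\<phi>\<close> is represented by its values
  at points, which are well defined for almost every \<open>\<xi>\<close> if \<open>f\<close> is integrable and \<open>\<phi>\<close> is
  square-integrable.
\<close>

definition group_fourier ::
    "real \<Rightarrow> (heis \<Rightarrow> complex) \<Rightarrow> (real \<Rightarrow> complex) \<Rightarrow> real \<Rightarrow> complex" where
  "group_fourier lam f \<phi> \<xi> = (LINT p|lborel. f p * schroedinger lam p \<phi> \<xi>)"

definition central_ft :: "real \<Rightarrow> (heis \<Rightarrow> complex) \<Rightarrow> real \<Rightarrow> real \<Rightarrow> complex" where
  "central_ft lam f x y = (LINT t|lborel. f (x, y, t) * exp (2 * pi * \<i> * lam * t))"

text \<open>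
  This pointwise formula fixes one representative of the kernel of the integral operator
  \<open>group_fourier lam f\<close> with \<open>F = central_ft lam f\<close>; see \<open>group_fourier_kernel\<close> and
  \<open>group_fourier_bspline\<close> below.
\<close>

definition weyl_kernel :: "real \<Rightarrow> (real \<Rightarrow> real \<Rightarrow> complex) \<Rightarrow> real \<Rightarrow> real \<Rightarrow> complex" where
  "weyl_kernel lam F \<xi> \<eta> = (LINT x|lborel. F x (\<eta> - \<xi>) * exp (pi * \<i> * lam * x * (\<xi> + \<eta>)))"

definition bspline_kernel :: "real \<Rightarrow> nat \<Rightarrow> real \<Rightarrow> real \<Rightarrow> complex" where
  "bspline_kernel lam n = weyl_kernel lam (central_ft lam (bspline n))"

text \<open>Normalised, unlike the \<open>sinc\<close> of HOL-Probability.\<close>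

definition nsinc :: "real \<Rightarrow> real" where
  "nsinc z = (if z = 0 then 1 else sin (pi * z) / (pi * z))"


section \<open>The kernel represents the group Fourier transform\<close>

lemma continuous_heis_div: "continuous_on UNIV (\<lambda>z. heis_mult (fst z) (heis_inv (snd z)))"
  unfolding heis_mult_def heis_inv_def case_prod_beta by (intro continuous_intros)

lemma measurable_heis_div2:
  assumes "F \<in> borel_measurable borel"
  shows "(\<lambda>z. F (heis_mult (fst z) (heis_inv (snd z)))) \<in> borel_measurable (borel \<Otimes>\<^sub>M borel)"
  unfolding borel_prod
  by (rule measurable_compose[OF borel_measurable_continuous_onI[OF continuous_heis_div] assms])

lemma measurable_heis_div:
  assumes "F \<in> borel_measurable borel"
  shows "(\<lambda>p. F (heis_mult p (heis_inv q))) \<in> borel_measurable borel"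
  by (rule measurable_compose[OF borel_measurable_continuous_onI assms])
    (auto simp: heis_mult_def heis_inv_def case_prod_beta intro!: continuous_intros)

lemma nn_integral_heis:
  fixes F :: "heis \<Rightarrow> ennreal"
  assumes [measurable]: "F \<in> borel_measurable borel"
  shows "(\<integral>\<^sup>+p. F p \<partial>lborel) = (\<integral>\<^sup>+x. \<integral>\<^sup>+y. \<integral>\<^sup>+t. F (x, y, t) \<partial>lborel \<partial>lborel \<partial>lborel)"
proof -
  have "(\<integral>\<^sup>+p. F p \<partial>lborel) = (\<integral>\<^sup>+p. F p \<partial>(lborel \<Otimes>\<^sub>M lborel))"
    by (simp add: lborel_prod)
  also have "\<dots> = (\<integral>\<^sup>+x. \<integral>\<^sup>+q. F (x, q) \<partial>lborel \<partial>lborel)"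
    by (rule lborel.nn_integral_fst[symmetric]) (simp add: lborel_prod)
  also have "\<dots> = (\<integral>\<^sup>+x. \<integral>\<^sup>+q. F (x, q) \<partial>(lborel \<Otimes>\<^sub>M lborel) \<partial>lborel)"
    by (simp add: lborel_prod)
  also have "\<dots> = (\<integral>\<^sup>+x. \<integral>\<^sup>+y. \<integral>\<^sup>+t. F (x, y, t) \<partial>lborel \<partial>lborel \<partial>lborel)"
    by (intro nn_integral_cong lborel.nn_integral_fst[symmetric]) (simp add: lborel_prod)
  finally show ?thesis .
qed

lemma nn_integral_heis_translate:
  fixes F :: "heis \<Rightarrow> ennreal"
  assumes [measurable]: "F \<in> borel_measurable borel"
  shows "(\<integral>\<^sup>+p. F (heis_mult p (heis_inv q)) \<partial>lborel) = (\<integral>\<^sup>+p. F p \<partial>lborel)"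
proof -
  obtain u v s where q: "q = (u, v, s)" by (cases q)
  have tr: "(\<integral>\<^sup>+x. g (x + a) \<partial>lborel) = (\<integral>\<^sup>+x. g x \<partial>lborel)"
    if [measurable]: "g \<in> borel_measurable borel" for g :: "real \<Rightarrow> ennreal" and a
    using nn_integral_real_affine[of g 1 a] by (simp add: add.commute)
  have m: "(\<lambda>p. F (heis_mult p (heis_inv q))) \<in> borel_measurable borel"
    by (rule measurable_heis_div) fact
  have "(\<integral>\<^sup>+p. F (heis_mult p (heis_inv q)) \<partial>lborel)
      = (\<integral>\<^sup>+x. \<integral>\<^sup>+y. \<integral>\<^sup>+t. F (x + - u, y + - v, t + (- s + 1/2 * (- u * y - - v * x)))
            \<partial>lborel \<partial>lborel \<partial>lborel)"
    by (subst nn_integral_heis[OF m]) (simp add: q heis_mult_def heis_inv_def add.assoc)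
  also have "\<dots> = (\<integral>\<^sup>+x. \<integral>\<^sup>+y. \<integral>\<^sup>+t. F (x + - u, y + - v, t) \<partial>lborel \<partial>lborel \<partial>lborel)"
    by (intro nn_integral_cong tr) measurable
  also have "\<dots> = (\<integral>\<^sup>+x. \<integral>\<^sup>+y. \<integral>\<^sup>+t. F (x + - u, y, t) \<partial>lborel \<partial>lborel \<partial>lborel)"
    by (intro nn_integral_cong tr[of "\<lambda>y. \<integral>\<^sup>+t. F (_ + - u, y, t) \<partial>lborel"]) measurable
  also have "\<dots> = (\<integral>\<^sup>+x. \<integral>\<^sup>+y. \<integral>\<^sup>+t. F (x, y, t) \<partial>lborel \<partial>lborel \<partial>lborel)"
    by (intro tr[of "\<lambda>x. \<integral>\<^sup>+y. \<integral>\<^sup>+t. F (x, y, t) \<partial>lborel \<partial>lborel"]) measurable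
  finally show ?thesis by (simp add: nn_integral_heis)
qed

lemma norm_integral_le_nn_integral:
  fixes f :: "'a \<Rightarrow> complex"
  shows "ennreal (norm (integral\<^sup>L M f)) \<le> (\<integral>\<^sup>+x. norm (f x) \<partial>M)"
  by (cases "integrable M f") (auto simp: integral_norm_bound_ennreal not_integrable_integral_eq)

lemma integrable_heis_conv:
  assumes f: "integrable lborel f" and g: "integrable lborel g"
  shows "integrable lborel (heis_conv f g)"
proof -
  have [measurable]: "f \<in> borel_measurable borel" "g \<in> borel_measurable borel"
    using f g by auto
  have m: "(\<lambda>(p, q). f (heis_mult p (heis_inv q)) * g q) \<in> borel_measurable (borel \<Otimes>\<^sub>M borel)"
    unfolding case_prod_beta by (intro borel_measurable_times measurable_heis_div2) measurable
  have [measurable]: "heis_conv f g \<in> borel_measurable borel"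
    using lborel.borel_measurable_lebesgue_integral[of "\<lambda>p q. f (heis_mult p (heis_inv q)) * g q" borel] m
    by (simp add: heis_conv_def[abs_def] cong: measurable_cong_sets)
  have "(\<integral>\<^sup>+p. norm (heis_conv f g p) \<partial>lborel)
      \<le> (\<integral>\<^sup>+p. \<integral>\<^sup>+q. norm (f (heis_mult p (heis_inv q)) * g q) \<partial>lborel \<partial>lborel)"
    unfolding heis_conv_def by (intro nn_integral_mono norm_integral_le_nn_integral)
  also have "\<dots> = (\<integral>\<^sup>+q. \<integral>\<^sup>+p. norm (f (heis_mult p (heis_inv q)) * g q) \<partial>lborel \<partial>lborel)"
    using m by (intro lborel_pair.Fubini'[symmetric]) (auto simp: case_prod_beta cong: measurable_cong_sets)
  also have "\<dots> = (\<integral>\<^sup>+q. (\<integral>\<^sup>+p. norm (f p) \<partial>lborel) * norm (g q) \<partial>lborel)"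
  proof (rule nn_integral_cong)
    fix q
    have m: "(\<lambda>p. f (heis_mult p (heis_inv q))) \<in> borel_measurable borel"
      by (rule measurable_heis_div) fact
    have "(\<integral>\<^sup>+p. norm (f (heis_mult p (heis_inv q)) * g q) \<partial>lborel)
        = (\<integral>\<^sup>+p. norm (f (heis_mult p (heis_inv q))) \<partial>lborel) * norm (g q)"
      using m by (simp add: norm_mult ennreal_mult nn_integral_multc)
    then show "(\<integral>\<^sup>+p. norm (f (heis_mult p (heis_inv q)) * g q) \<partial>lborel)
        = (\<integral>\<^sup>+p. norm (f p) \<partial>lborel) * norm (g q)"
      by (simp add: nn_integral_heis_translate[of "\<lambda>p. ennreal (norm (f p))"])
  qed
  also have "\<dots> = (\<integral>\<^sup>+p. norm (f p) \<partial>lborel) * (\<integral>\<^sup>+q. norm (g q) \<partial>lborel)"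
    by (simp add: nn_integral_cmult)
  also have "\<dots> < \<infinity>"
    using f g by (simp add: integrable_iff_bounded ennreal_mult_less_top)
  finally show ?thesis by (simp add: integrable_iff_bounded)
qed

lemma integrable_bspline: "integrable lborel (bspline n)"
proof (induction n rule: bspline.induct)
  case 2
  have "({0..2} \<times> {0..1} \<times> {0..1} :: heis set) = cbox (0, 0, 0) (2, 1, 1)"
    by (simp add: cbox_Pair_eq)
  then have "integrable lborel (indicator ({0..2} \<times> {0..1} \<times> {0..1} :: heis set) :: heis \<Rightarrow> real)"
    by (metis emeasure_lborel_cbox_finite integrable_real_indicator borel_closed closed_cbox sets_lborel)
  then have "integrable lborel
      (\<lambda>p. complex_of_real (indicator ({0..2} \<times> {0..1} \<times> {0..1} :: heis set) p))"
    by (rule integrable_of_real)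
  then show ?case
    by (simp add: of_real_indicator del: of_real_divide)
qed (auto simp del: bspline.simps(2) intro: integrable_heis_conv)

lemma integral_heis_swap:
  fixes h :: "heis \<Rightarrow> complex"
  assumes h: "integrable lborel h"
  shows "(LINT p|lborel. h p) = (LINT y|lborel. LINT x|lborel. LINT t|lborel. h (x, y, t))"
proof -
  have [measurable]: "h \<in> borel_measurable borel" using h by auto
  define H where "H = (\<lambda>x y. LINT t|lborel. h (x, y, t))"
  have Hm: "case_prod H \<in> borel_measurable (borel \<Otimes>\<^sub>M borel)"
    unfolding H_def case_prod_beta by measurable
  then have Hm' [measurable]: "case_prod H \<in> borel_measurable (lborel \<Otimes>\<^sub>M lborel)"
    by (simp cong: measurable_cong_sets)
  have "(\<integral>\<^sup>+z. norm (case_prod H z) \<partial>(lborel \<Otimes>\<^sub>M lborel))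
      = (\<integral>\<^sup>+x. \<integral>\<^sup>+y. norm (H x y) \<partial>lborel \<partial>lborel)"
    by (subst lborel.nn_integral_fst[symmetric]) auto
  also have "\<dots> \<le> (\<integral>\<^sup>+x. \<integral>\<^sup>+y. \<integral>\<^sup>+t. norm (h (x, y, t)) \<partial>lborel \<partial>lborel \<partial>lborel)"
    unfolding H_def by (intro nn_integral_mono norm_integral_le_nn_integral)
  also have "\<dots> = (\<integral>\<^sup>+p. norm (h p) \<partial>lborel)"
    by (simp add: nn_integral_heis)
  also have "\<dots> < \<infinity>"
    using h by (simp add: integrable_iff_bounded)
  finally have Hint: "integrable (lborel \<Otimes>\<^sub>M lborel) (case_prod H)"
    by (simp add: integrable_iff_bounded)
  have hint: "integrable (lborel \<Otimes>\<^sub>M lborel) (case_prod (\<lambda>x q. h (x, q)))"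
    using h by (simp add: lborel_prod)
  have "(LINT p|lborel. h p) = (LINT x|lborel. LINT q|lborel. h (x, q))"
    using lborel_pair.integral_fst'[of h] h by (simp add: lborel_prod)
  also have "\<dots> = (LINT x|lborel. LINT y|lborel. H x y)"
  proof (rule integral_cong_AE)
    show "(\<lambda>x. LINT q|lborel. h (x, q)) \<in> borel_measurable lborel" by measurable
    show "(\<lambda>x. LINT y|lborel. H x y) \<in> borel_measurable lborel" by measurable
    show "AE x in lborel. (LINT q|lborel. h (x, q)) = (LINT y|lborel. H x y)"
      using lborel_pair.AE_integrable_fst[OF hint]
    proof eventually_elim
      case (elim x)
      then show ?case
        using lborel_pair.integral_fst'[of "\<lambda>q. h (x, q)"] by (simp add: H_def lborel_prod)
    qed
  qed
  also have "\<dots> = (LINT y|lborel. LINT x|lborel. H x y)"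
    using lborel_pair.Fubini_integral[OF Hint] by simp
  finally show ?thesis by (simp add: H_def)
qed

lemma schroedinger_measurable:
  assumes [measurable]: "\<phi> \<in> borel_measurable borel"
  shows "(\<lambda>p. schroedinger lam p \<phi> \<xi>) \<in> borel_measurable borel"
proof -
  have \<phi>: "(\<lambda>p::heis. \<phi> (\<xi> + fst (snd p))) \<in> borel_measurable borel"
    by (rule measurable_compose[OF borel_measurable_continuous_onI assms])
      (intro continuous_intros)
  show ?thesis
    unfolding schroedinger_def case_prod_beta
    by (intro borel_measurable_times \<phi> borel_measurable_continuous_onI continuous_intros)
qed

lemma norm_schroedinger: "norm (schroedinger lam p \<phi> \<xi>) = norm (\<phi> (\<xi> + fst (snd p)))"
proof -
  obtain x y t where p: "p = (x, y, t)" by (cases p)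
  have [simp]: "norm (exp (2 * pi * \<i> * lam * r)) = 1" for r :: real
    by simp
  have "norm (exp (2 * pi * \<i> * lam * (x * \<xi> + 1/2 * x * y))) = 1"
    by simp
  then show ?thesis
    by (simp add: p schroedinger_def norm_mult)
qed

lemma AE_integrable_schroedinger:
  assumes f: "integrable lborel f"
    and \<phi> [measurable]: "\<phi> \<in> borel_measurable lborel"
    and \<phi>2: "integrable lborel (\<lambda>\<xi>. (norm (\<phi> \<xi>))\<^sup>2)"
  shows "AE \<xi> in lborel. integrable lborel (\<lambda>p. f p * schroedinger lam p \<phi> \<xi>)"
proof -
  have [measurable]: "f \<in> borel_measurable borel" using f by auto
  have phm [measurable]: "\<phi> \<in> borel_measurable borel" using \<phi> by simp
  define G where "G = (\<lambda>\<xi> p. ennreal (norm (f p) * norm (\<phi> (\<xi> + fst (snd p)))))"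
  have "(\<lambda>z::real \<times> heis. \<phi> (fst z + fst (snd (snd z)))) \<in> borel_measurable borel"
    by (rule measurable_compose[OF borel_measurable_continuous_onI phm])
      (intro continuous_intros)
  then have [measurable]:
    "(\<lambda>z::real \<times> heis. \<phi> (fst z + fst (snd (snd z)))) \<in> borel_measurable (borel \<Otimes>\<^sub>M borel)"
    by (simp add: borel_prod)
  have Gm: "(\<lambda>(\<xi>, p). G \<xi> p) \<in> borel_measurable (borel \<Otimes>\<^sub>M borel)"
    unfolding G_def case_prod_beta by measurable
  then have [measurable]: "(\<lambda>(\<xi>, p). G \<xi> p) \<in> borel_measurable (lborel \<Otimes>\<^sub>M lborel)"
    by (simp cong: measurable_cong_sets)
  have "AE \<xi> in lborel. \<xi> \<in> {- real n..real n} \<longrightarrow> (\<integral>\<^sup>+p. G \<xi> p \<partial>lborel) < \<infinity>" for n :: nat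
  proof -
    let ?I = "\<lambda>\<xi>. indicator {- real n..real n} \<xi> :: ennreal"
    have "(\<integral>\<^sup>+\<xi>. (\<integral>\<^sup>+p. G \<xi> p \<partial>lborel) * ?I \<xi> \<partial>lborel)
        = (\<integral>\<^sup>+\<xi>. \<integral>\<^sup>+p. G \<xi> p * ?I \<xi> \<partial>lborel \<partial>lborel)"
      by (intro nn_integral_cong nn_integral_multc[symmetric]) measurable
    also have "\<dots> = (\<integral>\<^sup>+p. \<integral>\<^sup>+\<xi>. G \<xi> p * ?I \<xi> \<partial>lborel \<partial>lborel)"
      by (intro lborel_pair.Fubini'[symmetric]) measurable
    also have "\<dots> \<le> (\<integral>\<^sup>+p. norm (f p) * (2 * real n + (\<integral>\<^sup>+\<xi>. (norm (\<phi> \<xi>))\<^sup>2 \<partial>lborel)) \<partial>lborel)"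
    proof (rule nn_integral_mono)
      fix p :: heis
      define y where "y = fst (snd p)"
      have le: "r \<le> 1 + r\<^sup>2" for r :: real
        using zero_le_power2[of "r - 1/2"] by (simp add: power2_eq_square algebra_simps)
      have "(\<integral>\<^sup>+\<xi>. G \<xi> p * ?I \<xi> \<partial>lborel)
          \<le> (\<integral>\<^sup>+\<xi>. norm (f p) * (?I \<xi> + (norm (\<phi> (\<xi> + y)))\<^sup>2) \<partial>lborel)"
      proof (rule nn_integral_mono)
        fix \<xi> :: real
        have "ennreal (norm (\<phi> (\<xi> + y))) \<le> 1 + (norm (\<phi> (\<xi> + y)))\<^sup>2"
          using le[of "norm (\<phi> (\<xi> + y))"]
          by (metis ennreal_1 ennreal_leI ennreal_plus zero_le_one zero_le_power2)
        then show "G \<xi> p * ?I \<xi> \<le> norm (f p) * (?I \<xi> + (norm (\<phi> (\<xi> + y)))\<^sup>2)"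
          by (auto simp: G_def y_def ennreal_mult indicator_def intro!: mult_left_mono)
      qed
      also have "\<dots> = norm (f p) * ((\<integral>\<^sup>+\<xi>. ?I \<xi> \<partial>lborel) + (\<integral>\<^sup>+\<xi>. (norm (\<phi> (\<xi> + y)))\<^sup>2 \<partial>lborel))"
        by (simp add: nn_integral_cmult nn_integral_add)
      also have "(\<integral>\<^sup>+\<xi>. (norm (\<phi> (\<xi> + y)))\<^sup>2 \<partial>lborel) = (\<integral>\<^sup>+\<xi>. (norm (\<phi> \<xi>))\<^sup>2 \<partial>lborel)"
        using nn_integral_real_affine[of "\<lambda>\<xi>. ennreal ((norm (\<phi> \<xi>))\<^sup>2)" 1 y]
        by (simp add: add.commute)
      finally show "(\<integral>\<^sup>+\<xi>. G \<xi> p * ?I \<xi> \<partial>lborel)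
          \<le> norm (f p) * (2 * real n + (\<integral>\<^sup>+\<xi>. (norm (\<phi> \<xi>))\<^sup>2 \<partial>lborel))"
        by (simp add: ennreal_mult)
    qed
    also have "\<dots> = (\<integral>\<^sup>+p. norm (f p) \<partial>lborel) * (2 * real n + (\<integral>\<^sup>+\<xi>. (norm (\<phi> \<xi>))\<^sup>2 \<partial>lborel))"
      by (simp add: nn_integral_multc)
    also have "\<dots> < \<infinity>"
      using f \<phi>2 by (simp add: integrable_iff_bounded ennreal_mult_less_top)
    finally have "AE \<xi> in lborel. (\<integral>\<^sup>+p. G \<xi> p \<partial>lborel) * ?I \<xi> \<noteq> \<infinity>"
      by (intro nn_integral_PInf_AE) auto
    then show ?thesis
      by eventually_elim (auto simp: less_top)
  qed
  then have "AE \<xi> in lborel. \<forall>n::nat. \<xi> \<in> {- real n..real n} \<longrightarrow> (\<integral>\<^sup>+p. G \<xi> p \<partial>lborel) < \<infinity>"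
    by (simp only: AE_all_countable) blast
  then show ?thesis
  proof eventually_elim
    case (elim \<xi>)
    obtain n :: nat where "\<bar>\<xi>\<bar> \<le> real n" using real_arch_simple by blast
    then have "(\<integral>\<^sup>+p. G \<xi> p \<partial>lborel) < \<infinity>" using elim by (auto simp: abs_le_iff)
    then show ?case
      using schroedinger_measurable[OF phm, of lam \<xi>]
      by (simp add: integrable_iff_bounded G_def norm_mult norm_schroedinger)
  qed
qed

theorem group_fourier_kernel:
  assumes f: "integrable lborel f"
    and \<phi>: "\<phi> \<in> borel_measurable lborel"
    and \<phi>2: "integrable lborel (\<lambda>\<xi>. (norm (\<phi> \<xi>))\<^sup>2)"
  shows "AE \<xi> in lborel. group_fourier lam f \<phi> \<xi>
    = (LINT \<eta>|lborel. weyl_kernel lam (central_ft lam f) \<xi> \<eta> * \<phi> \<eta>)"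
  using AE_integrable_schroedinger[OF assms, of lam]
proof eventually_elim
  case (elim \<xi>)
  let ?e = "\<lambda>x y. exp (2 * pi * \<i> * lam * (x * \<xi> + 1/2 * x * y)) :: complex"
  have inner: "(LINT t|lborel. f (x, y, t) * schroedinger lam (x, y, t) \<phi> \<xi>)
      = central_ft lam f x y * ?e x y * \<phi> (\<xi> + y)" for x y
  proof -
    have "(LINT t|lborel. f (x, y, t) * schroedinger lam (x, y, t) \<phi> \<xi>)
        = (LINT t|lborel. (f (x, y, t) * exp (2 * pi * \<i> * lam * t)) * (?e x y * \<phi> (\<xi> + y)))"
      by (simp add: schroedinger_def mult.assoc)
    also have "\<dots> = central_ft lam f x y * (?e x y * \<phi> (\<xi> + y))"
      unfolding central_ft_def by (rule integral_mult_left_zero)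
    finally show ?thesis by (simp only: mult.assoc)
  qed
  have "group_fourier lam f \<phi> \<xi>
      = (LINT y|lborel. LINT x|lborel. central_ft lam f x y * ?e x y * \<phi> (\<xi> + y))"
    unfolding group_fourier_def integral_heis_swap[OF elim] inner ..
  also have "\<dots> = (LINT y|lborel. weyl_kernel lam (central_ft lam f) \<xi> (\<xi> + 1 * y) * \<phi> (\<xi> + 1 * y))"
  proof -
    have "?e x y = exp (pi * \<i> * lam * x * (\<xi> + (\<xi> + 1 * y)))" for x y
      by (simp add: algebra_simps)
    then have "(LINT x|lborel. central_ft lam f x y * ?e x y * \<phi> (\<xi> + y))
        = weyl_kernel lam (central_ft lam f) \<xi> (\<xi> + 1 * y) * \<phi> (\<xi> + 1 * y)" for y
      by (simp add: weyl_kernel_def)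
    then show ?thesis by presburger
  qed
  also have "\<dots> = (LINT \<eta>|lborel. weyl_kernel lam (central_ft lam f) \<xi> \<eta> * \<phi> \<eta>)"
    using lborel_integral_real_affine[of 1
        "\<lambda>\<eta>. weyl_kernel lam (central_ft lam f) \<xi> \<eta> * \<phi> \<eta>" \<xi>] by simp
  finally show ?case .
qed

corollary group_fourier_bspline:
  assumes "\<phi> \<in> borel_measurable lborel"
    and "integrable lborel (\<lambda>\<xi>. (norm (\<phi> \<xi>))\<^sup>2)"
  shows "AE \<xi> in lborel. group_fourier lam (bspline n) \<phi> \<xi>
    = (LINT \<eta>|lborel. bspline_kernel lam n \<xi> \<eta> * \<phi> \<eta>)"
  unfolding bspline_kernel_def by (rule group_fourier_kernel[OF integrable_bspline assms])

end

theory Submission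
  imports Defs
begin

text \<open>
  The group Fourier transform turns convolution into composition of operators, so the kernel of
  a convolution is the composition of the kernels of its factors.  To make this hold at every
  point, and not just almost everywhere, we carry along a uniform bound on the \<open>L\<^sup>1\<close> norms of the
  slices \<open>y = const\<close>; such a bound passes from \<open>f\<close> to the convolution of \<open>f\<close> with
  any integrable \<open>g\<close>.
\<close>

section \<open>Slices \<open>y = const\<close> under translation and convolution\<close>

lemma nn_integral_real_translate:
  fixes g :: "real \<Rightarrow> ennreal"
  assumes [measurable]: "g \<in> borel_measurable borel"
  shows "(\<integral>\<^sup>+x. g (x + a) \<partial>lborel) = (\<integral>\<^sup>+x. g x \<partial>lborel)"
  using nn_integral_real_affine[of g 1 a] by (simp add: add.commute)

lemma integral_real_translate:
  fixes g :: "real \<Rightarrow> complex"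
  shows "(LINT x|lborel. g (x + a)) = (LINT x|lborel. g x)"
  using lborel_integral_real_affine[of 1 g a] by (simp add: add.commute)

text \<open>Right multiplication by the inverse of \<open>q = (u, v, s)\<close> carries the slice at
  height \<open>y\<close> to the slice at height \<open>y - v\<close>. It shifts \<open>x\<close> by
  \<open>- u\<close> and shears \<open>t\<close> by an amount depending on \<open>x\<close>;
  integrating over \<open>t\<close> first, with \<open>x\<close> fixed, turns the shear into a plain
  translation.\<close>

lemma nn_integral_slice_translate:
  fixes F :: "heis \<Rightarrow> ennreal"
  assumes [measurable]: "F \<in> borel_measurable borel"
  shows "(\<integral>\<^sup>+x. \<integral>\<^sup>+t. F (heis_mult (x, y, t) (heis_inv q)) \<partial>lborel \<partial>lborel)
    = (\<integral>\<^sup>+x. \<integral>\<^sup>+t. F (x, y - fst (snd q), t) \<partial>lborel \<partial>lborel)"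
proof -
  obtain u v s where q: "q = (u, v, s)" by (cases q)
  have "(\<integral>\<^sup>+x. \<integral>\<^sup>+t. F (heis_mult (x, y, t) (heis_inv q)) \<partial>lborel \<partial>lborel)
      = (\<integral>\<^sup>+x. \<integral>\<^sup>+t. F (x + - u, y - v, t + (- s + 1/2 * (- u * y - - v * x))) \<partial>lborel \<partial>lborel)"
    by (simp add: q heis_mult_def heis_inv_def add.assoc)
  also have "\<dots> = (\<integral>\<^sup>+x. \<integral>\<^sup>+t. F (x + - u, y - v, t) \<partial>lborel \<partial>lborel)"
    by (intro nn_integral_cong nn_integral_real_translate) measurable
  also have "\<dots> = (\<integral>\<^sup>+x. \<integral>\<^sup>+t. F (x, y - v, t) \<partial>lborel \<partial>lborel)"
    by (intro nn_integral_real_translate[of "\<lambda>x. \<integral>\<^sup>+t. F (x, y - v, t) \<partial>lborel"]) measurable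
  finally show ?thesis by (simp add: q)
qed

lemma measurable_slice_div:
  assumes F: "F \<in> borel_measurable borel"
  shows "(\<lambda>(z, q). F (heis_mult (fst z, y, snd z) (heis_inv q)))
    \<in> borel_measurable ((lborel \<Otimes>\<^sub>M lborel) \<Otimes>\<^sub>M lborel)"
proof -
  have c: "continuous_on UNIV (\<lambda>w::(real \<times> real) \<times> heis. heis_mult (fst (fst w), y, snd (fst w)) (heis_inv (snd w)))"
    unfolding heis_mult_def heis_inv_def case_prod_beta by (intro continuous_intros)
  show ?thesis
    using measurable_compose[OF borel_measurable_continuous_onI[OF c] F]
    by (simp add: case_prod_beta lborel_prod)
qed

text \<open>By Tonelli the slice variable \<open>z = (x, t)\<close> can be integrated first. For
  each \<open>q\<close> this gives an integral of \<open>F\<close> over another slice, whose height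
  depends on \<open>q\<close>; hence the bound \<open>C\<close> has to be uniform in
  \<open>y\<close>. The form with values in \<open>ennreal\<close> serves both the slice bound of a
  convolution and the integrability needed for Fubini.\<close>

lemma nn_integral_slice_conv:
  fixes F G :: "heis \<Rightarrow> ennreal"
  assumes F [measurable]: "F \<in> borel_measurable borel" and [measurable]: "G \<in> borel_measurable borel"
    and C: "\<And>y. (\<integral>\<^sup>+x. \<integral>\<^sup>+t. F (x, y, t) \<partial>lborel \<partial>lborel) \<le> C"
  shows "(\<integral>\<^sup>+z. \<integral>\<^sup>+q. F (heis_mult (fst z, y, snd z) (heis_inv q)) * G q \<partial>lborel \<partial>(lborel \<Otimes>\<^sub>M lborel))
    \<le> C * (\<integral>\<^sup>+q. G q \<partial>lborel)"
proof -
  interpret P: pair_sigma_finite "lborel \<Otimes>\<^sub>M lborel :: (real \<times> real) measure" "lborel :: heis measure"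
    by (simp add: lborel_prod pair_sigma_finite_def sigma_finite_lborel)
  note m [measurable] = measurable_slice_div[OF F, of y]
  have m1 [measurable]: "(\<lambda>z. F (heis_mult (fst z, y, snd z) (heis_inv q))) \<in> borel_measurable (lborel \<Otimes>\<^sub>M lborel)" for q
    using measurable_compose[OF measurable_Pair2' m, of q] by simp
  have "(\<integral>\<^sup>+z. \<integral>\<^sup>+q. F (heis_mult (fst z, y, snd z) (heis_inv q)) * G q \<partial>lborel \<partial>(lborel \<Otimes>\<^sub>M lborel))
      = (\<integral>\<^sup>+q. \<integral>\<^sup>+z. F (heis_mult (fst z, y, snd z) (heis_inv q)) * G q \<partial>(lborel \<Otimes>\<^sub>M lborel) \<partial>lborel)"
    by (intro P.Fubini'[symmetric]) (use m in \<open>simp add: case_prod_beta\<close>)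
  also have "\<dots> = (\<integral>\<^sup>+q. (\<integral>\<^sup>+x. \<integral>\<^sup>+t. F (x, y - fst (snd q), t) \<partial>lborel \<partial>lborel) * G q \<partial>lborel)"
  proof (intro nn_integral_cong)
    fix q
    have "(\<integral>\<^sup>+z. F (heis_mult (fst z, y, snd z) (heis_inv q)) * G q \<partial>(lborel \<Otimes>\<^sub>M lborel))
        = (\<integral>\<^sup>+z. F (heis_mult (fst z, y, snd z) (heis_inv q)) \<partial>(lborel \<Otimes>\<^sub>M lborel)) * G q"
      by (rule nn_integral_multc) measurable
    also have "(\<integral>\<^sup>+z. F (heis_mult (fst z, y, snd z) (heis_inv q)) \<partial>(lborel \<Otimes>\<^sub>M lborel))
        = (\<integral>\<^sup>+x. \<integral>\<^sup>+t. F (heis_mult (x, y, t) (heis_inv q)) \<partial>lborel \<partial>lborel)"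
      by (subst lborel.nn_integral_fst[symmetric]) auto
    finally show "(\<integral>\<^sup>+z. F (heis_mult (fst z, y, snd z) (heis_inv q)) * G q \<partial>(lborel \<Otimes>\<^sub>M lborel))
        = (\<integral>\<^sup>+x. \<integral>\<^sup>+t. F (x, y - fst (snd q), t) \<partial>lborel \<partial>lborel) * G q"
      by (simp add: nn_integral_slice_translate[OF F])
  qed
  also have "\<dots> \<le> (\<integral>\<^sup>+q. C * G q \<partial>lborel)"
    by (intro nn_integral_mono mult_right_mono C) auto
  also have "\<dots> = C * (\<integral>\<^sup>+q. G q \<partial>lborel)"
    by (rule nn_integral_cmult) simp
  finally show ?thesis .
qed

text \<open>The new bound again does not depend on \<open>y\<close>, so the estimate can be iterated
  along the recursion of the splines. Only the left factor needs bounded slices; of \<open>g\<close>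
  only the \<open>L^1\<close> norm enters.\<close>

lemma slice_bound_heis_conv:
  assumes f: "integrable lborel f" and g: "integrable lborel g"
    and C: "\<And>y. (\<integral>\<^sup>+x. \<integral>\<^sup>+t. norm (f (x, y, t)) \<partial>lborel \<partial>lborel) \<le> C"
  shows "(\<integral>\<^sup>+x. \<integral>\<^sup>+t. norm (heis_conv f g (x, y, t)) \<partial>lborel \<partial>lborel) \<le> C * (\<integral>\<^sup>+q. norm (g q) \<partial>lborel)"
proof -
  have [measurable]: "f \<in> borel_measurable borel" "g \<in> borel_measurable borel"
    "heis_conv f g \<in> borel_measurable borel"
    using f g integrable_heis_conv[OF f g] by auto
  have "(\<integral>\<^sup>+x. \<integral>\<^sup>+t. norm (heis_conv f g (x, y, t)) \<partial>lborel \<partial>lborel)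
      = (\<integral>\<^sup>+z. norm (heis_conv f g (fst z, y, snd z)) \<partial>(lborel \<Otimes>\<^sub>M lborel))"
    by (subst lborel.nn_integral_fst[symmetric]) auto
  also have "\<dots> \<le> (\<integral>\<^sup>+z. \<integral>\<^sup>+q. norm (f (heis_mult (fst z, y, snd z) (heis_inv q)) * g q)
      \<partial>lborel \<partial>(lborel \<Otimes>\<^sub>M lborel))"
    unfolding heis_conv_def by (intro nn_integral_mono norm_integral_le_nn_integral)
  also have "\<dots> = (\<integral>\<^sup>+z. \<integral>\<^sup>+q. ennreal (norm (f (heis_mult (fst z, y, snd z) (heis_inv q)))) * norm (g q)
      \<partial>lborel \<partial>(lborel \<Otimes>\<^sub>M lborel))"
    by (simp add: norm_mult ennreal_mult)
  also have "\<dots> \<le> C * (\<integral>\<^sup>+q. norm (g q) \<partial>lborel)"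
    by (rule nn_integral_slice_conv[of "\<lambda>p. ennreal (norm (f p))" "\<lambda>p. ennreal (norm (g p))"])
      (use C in auto)
  finally show ?thesis .
qed

section \<open>The kernel of a convolution\<close>

text \<open>This is the kernel form of the homomorphism property: with \<open>q = (u, v, s)\<close>,
  the right translate of \<open>f\<close> has as its Fourier transform that of \<open>f\<close>
  composed with the Schroedinger operator of \<open>q\<close>, which moves the second kernel
  variable by \<open>v\<close> and contributes the phase in front.\<close>

lemma weyl_kernel_translate:
  fixes f :: "heis \<Rightarrow> complex"
  shows "(LINT x|lborel. LINT t|lborel. f (heis_mult (x, \<eta> - \<xi>, t) (heis_inv (u, v, s)))
        * (exp (2 * pi * \<i> * lam * t) * exp (pi * \<i> * lam * x * (\<xi> + \<eta>))))
    = exp (2 * pi * \<i> * lam * s) * exp (pi * \<i> * lam * u * (2 * \<eta> - v))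
        * weyl_kernel lam (central_ft lam f) \<xi> (\<eta> - v)"
proof -
  \<comment> \<open>\<open>c x\<close> is the shift of the central coordinate caused by the group
    law, and \<open>B\<close> collects the phases free of \<open>x\<close> and
    \<open>t\<close>.\<close>
  define c where "c = (\<lambda>x. - s + 1/2 * (v * x - u * (\<eta> - \<xi>)))"
  define B :: complex where "B = exp (2 * pi * \<i> * lam * s) * exp (pi * \<i> * lam * u * (2 * \<eta> - v))"
  define g where "g = (\<lambda>x. central_ft lam f x (\<eta> - v - \<xi>) * exp (pi * \<i> * lam * x * (\<xi> + (\<eta> - v))))"
  have "(LINT t|lborel. f (heis_mult (x, \<eta> - \<xi>, t) (heis_inv (u, v, s)))
        * (exp (2 * pi * \<i> * lam * t) * exp (pi * \<i> * lam * x * (\<xi> + \<eta>)))) = B * g (x + - u)" for x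
  proof -
    \<comment> \<open>After division by \<open>pi * \<i> * lam\<close>, the term
      \<open>v * x\<close> of \<open>2 * c x\<close> cancels the \<open>- v * x\<close> that comes
      from replacing \<open>\<eta>\<close> by \<open>\<eta> - v\<close>; the remaining terms in
      \<open>u\<close> and \<open>s\<close> cancel against the exponent of \<open>B\<close>.\<close>
    have "exp (2 * pi * \<i> * lam * t) * exp (pi * \<i> * lam * x * (\<xi> + \<eta>))
        = exp (2 * pi * \<i> * lam * (t + c x)) * (B * exp (pi * \<i> * lam * (x + - u) * (\<xi> + (\<eta> - v))))" for t
      unfolding B_def c_def exp_add[symmetric] by (rule arg_cong[where f = exp]) (simp add: field_simps)
    moreover have "heis_mult (x, \<eta> - \<xi>, t) (heis_inv (u, v, s)) = (x + - u, \<eta> - v - \<xi>, t + c x)" for t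
      by (simp add: heis_mult_def heis_inv_def c_def field_simps)
    ultimately have "(LINT t|lborel. f (heis_mult (x, \<eta> - \<xi>, t) (heis_inv (u, v, s)))
        * (exp (2 * pi * \<i> * lam * t) * exp (pi * \<i> * lam * x * (\<xi> + \<eta>))))
      = (LINT t|lborel. (\<lambda>t. f (x + - u, \<eta> - v - \<xi>, t) * exp (2 * pi * \<i> * lam * t)
          * (B * exp (pi * \<i> * lam * (x + - u) * (\<xi> + (\<eta> - v))))) (t + c x))"
      by (simp only: mult.assoc)
    also have "\<dots> = (LINT t|lborel. f (x + - u, \<eta> - v - \<xi>, t) * exp (2 * pi * \<i> * lam * t)
          * (B * exp (pi * \<i> * lam * (x + - u) * (\<xi> + (\<eta> - v)))))"
      by (rule integral_real_translate[where g = "\<lambda>t. f (x + - u, \<eta> - v - \<xi>, t) * exp (2 * pi * \<i> * lam * t)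
          * (B * exp (pi * \<i> * lam * (x + - u) * (\<xi> + (\<eta> - v))))"])
    also have "\<dots> = central_ft lam f (x + - u) (\<eta> - v - \<xi>) * (B * exp (pi * \<i> * lam * (x + - u) * (\<xi> + (\<eta> - v))))"
      unfolding central_ft_def by (rule integral_mult_left_zero)
    finally show ?thesis by (simp add: g_def mult_ac)
  qed
  then have "(LINT x|lborel. LINT t|lborel. f (heis_mult (x, \<eta> - \<xi>, t) (heis_inv (u, v, s)))
        * (exp (2 * pi * \<i> * lam * t) * exp (pi * \<i> * lam * x * (\<xi> + \<eta>))))
      = (LINT x|lborel. B * g (x + - u))"
    by (simp only:)
  also have "\<dots> = B * (LINT x|lborel. g x)"
    by (simp only: integral_mult_right_zero integral_real_translate)
  finally show ?thesis by (simp only: B_def g_def weyl_kernel_def of_real_add of_real_diff of_real_mult of_real_numeral)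
qed

text \<open>The substitution \<open>\<zeta> = \<eta> - v\<close> shows the usual composition of
  kernels, integrated over the intermediate point \<open>\<zeta>\<close>. The variable
  \<open>v\<close> is kept because it is the middle coordinate of the point at which
  \<open>g\<close> is evaluated.\<close>

theorem weyl_kernel_heis_conv:
  assumes f: "integrable lborel f" and g: "integrable lborel g"
    and C: "\<And>y. (\<integral>\<^sup>+x. \<integral>\<^sup>+t. norm (f (x, y, t)) \<partial>lborel \<partial>lborel) \<le> C" and fin: "C < \<infinity>"
  shows "weyl_kernel lam (central_ft lam (heis_conv f g)) \<xi> \<eta>
    = (LINT v|lborel. weyl_kernel lam (central_ft lam g) (\<eta> - v) \<eta>
        * weyl_kernel lam (central_ft lam f) \<xi> (\<eta> - v))"
proof -
  interpret P: pair_sigma_finite "lborel \<Otimes>\<^sub>M lborel :: (real \<times> real) measure" "lborel :: heis measure"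
    by (simp add: lborel_prod pair_sigma_finite_def sigma_finite_lborel)
  have fm [measurable]: "f \<in> borel_measurable borel" and [measurable]: "g \<in> borel_measurable borel"
    using f g by auto
  define y where "y = \<eta> - \<xi>"
  define E :: "real \<times> real \<Rightarrow> complex" where
    "E = (\<lambda>z. exp (2 * pi * \<i> * lam * complex_of_real (snd z))
      * exp (pi * \<i> * lam * complex_of_real (fst z) * (\<xi> + \<eta>)))"
  \<comment> \<open>A single integrand for both sides: integrating over \<open>q\<close> first gives
    the convolution times the phase \<open>E\<close>, integrating over the slice variable
    \<open>z\<close> first gives a translated kernel of \<open>f\<close>.\<close>
  define h where "h = (\<lambda>z q. f (heis_mult (fst z, y, snd z) (heis_inv q)) * g q * E z)"
  have nE: "norm (E z) = 1" for z by (simp add: E_def norm_mult)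
  have "E \<in> borel_measurable borel"
    unfolding E_def by (intro borel_measurable_continuous_onI continuous_intros)
  then have [measurable]: "E \<in> borel_measurable (lborel \<Otimes>\<^sub>M lborel)"
    by (simp add: lborel_prod)
  note m [measurable] = measurable_slice_div[OF fm, of y]
  have hm: "case_prod h \<in> borel_measurable ((lborel \<Otimes>\<^sub>M lborel) \<Otimes>\<^sub>M lborel)"
    using m unfolding h_def case_prod_beta by measurable
  \<comment> \<open>The phase \<open>E\<close> has modulus 1, so absolute integrability of
    \<open>h\<close> reduces to the slice estimate and the finiteness of \<open>C\<close>.\<close>
  have hint: "integrable ((lborel \<Otimes>\<^sub>M lborel) \<Otimes>\<^sub>M lborel) (case_prod h)"
  proof -
    have "(\<integral>\<^sup>+w. norm (case_prod h w) \<partial>((lborel \<Otimes>\<^sub>M lborel) \<Otimes>\<^sub>M lborel))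
        = (\<integral>\<^sup>+z. \<integral>\<^sup>+q. norm (h z q) \<partial>lborel \<partial>(lborel \<Otimes>\<^sub>M lborel))"
      using hm by (subst lborel.nn_integral_fst[symmetric]) auto
    also have "\<dots> = (\<integral>\<^sup>+z. \<integral>\<^sup>+q. ennreal (norm (f (heis_mult (fst z, y, snd z) (heis_inv q)))) * norm (g q)
        \<partial>lborel \<partial>(lborel \<Otimes>\<^sub>M lborel))"
      by (simp add: h_def norm_mult ennreal_mult nE)
    also have "\<dots> \<le> C * (\<integral>\<^sup>+q. norm (g q) \<partial>lborel)"
      by (rule nn_integral_slice_conv[of "\<lambda>p. ennreal (norm (f p))" "\<lambda>p. ennreal (norm (g p))"])
        (use C in auto)
    also have "\<dots> < \<infinity>"
      using g fin by (simp add: integrable_iff_bounded ennreal_mult_less_top)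
    finally show ?thesis using hm by (simp add: integrable_iff_bounded)
  qed
  \<comment> \<open>The slice bound at height \<open>y - v\<close> makes \<open>k\<close> integrable
    for every \<open>q\<close>, so this evaluation holds everywhere and not just for almost every
    \<open>q\<close>.\<close>
  have inner: "(LINT z|(lborel \<Otimes>\<^sub>M lborel). h z q)
      = g q * (exp (2 * pi * \<i> * lam * complex_of_real (snd (snd q)))
        * exp (pi * \<i> * lam * complex_of_real (fst q) * (2 * \<eta> - fst (snd q)))
        * weyl_kernel lam (central_ft lam f) \<xi> (\<eta> - fst (snd q)))" for q
  proof -
    obtain u v s where q: "q = (u, v, s)" by (cases q)
    define k where "k = (\<lambda>z. f (heis_mult (fst z, y, snd z) (heis_inv q)) * E z)"
    have m1 [measurable]: "(\<lambda>z. f (heis_mult (fst z, y, snd z) (heis_inv q))) \<in> borel_measurable (lborel \<Otimes>\<^sub>M lborel)"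
      using measurable_compose[OF measurable_Pair2' m, of q] by simp
    have "(\<integral>\<^sup>+z. norm (k z) \<partial>(lborel \<Otimes>\<^sub>M lborel))
        = (\<integral>\<^sup>+x. \<integral>\<^sup>+t. norm (f (heis_mult (x, y, t) (heis_inv q))) \<partial>lborel \<partial>lborel)"
      by (subst lborel.nn_integral_fst[symmetric]) (auto simp: k_def norm_mult nE)
    also have "\<dots> \<le> C"
      using C by (subst nn_integral_slice_translate[of "\<lambda>p. ennreal (norm (f p))"]) auto
    also note fin
    finally have "integrable (lborel \<Otimes>\<^sub>M lborel) k"
      by (simp add: integrable_iff_bounded k_def)
    then have "(LINT z|(lborel \<Otimes>\<^sub>M lborel). k z) = (LINT x|lborel. LINT t|lborel. k (x, t))"
      by (rule lborel_pair.integral_fst'[symmetric])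
    also have "\<dots> = exp (2 * pi * \<i> * lam * s) * exp (pi * \<i> * lam * u * (2 * \<eta> - v))
        * weyl_kernel lam (central_ft lam f) \<xi> (\<eta> - v)"
      unfolding k_def E_def y_def q fst_conv snd_conv
      using weyl_kernel_translate[of f \<eta> \<xi> u v s lam]
      by (simp only: of_real_add of_real_diff of_real_mult of_real_numeral)
    finally have k: "(LINT z|(lborel \<Otimes>\<^sub>M lborel). k z) = \<dots>" .
    have "h z q = g q * k z" for z by (simp add: h_def k_def)
    then have "(LINT z|(lborel \<Otimes>\<^sub>M lborel). h z q) = g q * (LINT z|(lborel \<Otimes>\<^sub>M lborel). k z)"
      by (simp only: integral_mult_right_zero)
    then show ?thesis unfolding k by (simp only: q fst_conv snd_conv)
  qed
  \<comment> \<open>Pulling out \<open>E z\<close> requires no integrability: where the convolution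
    integral diverges, both sides have the default value 0.\<close>
  have H: "(LINT q|lborel. h z q) = heis_conv f g (fst z, y, snd z) * E z" for z
    unfolding h_def heis_conv_def by (rule integral_mult_left_zero)
  have "weyl_kernel lam (central_ft lam (heis_conv f g)) \<xi> \<eta>
      = (LINT x|lborel. LINT t|lborel. LINT q|lborel. h (x, t) q)"
    unfolding H unfolding weyl_kernel_def central_ft_def E_def y_def fst_conv snd_conv
    by (simp only: mult.assoc[symmetric] integral_mult_left_zero of_real_add)
  also have "\<dots> = (LINT z|(lborel \<Otimes>\<^sub>M lborel). LINT q|lborel. h z q)"
    using P.integrable_fst[OF hint] by (intro lborel_pair.integral_fst') simp
  also have "\<dots> = (LINT q|lborel. LINT z|(lborel \<Otimes>\<^sub>M lborel). h z q)"
    by (rule P.Fubini_integral[OF hint, symmetric])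
  \<comment> \<open>The middle coordinate \<open>v\<close> becomes the outermost variable, so the
    translated kernel of \<open>f\<close> is constant in the two inner integrals, which then form a
    kernel of \<open>g\<close>.\<close>
  also have "\<dots> = (LINT v|lborel. LINT u|lborel. LINT s|lborel. LINT z|(lborel \<Otimes>\<^sub>M lborel). h z (u, v, s))"
    by (rule integral_heis_swap[OF P.integrable_snd[OF hint]])
  also have "\<dots> = (LINT v|lborel. weyl_kernel lam (central_ft lam g) (\<eta> - v) \<eta>
        * weyl_kernel lam (central_ft lam f) \<xi> (\<eta> - v))"
  proof (rule arg_cong[where f = "integral\<^sup>L lborel"], rule ext)
    fix v
    let ?K = "weyl_kernel lam (central_ft lam f) \<xi> (\<eta> - v)"
    have "(LINT u|lborel. LINT s|lborel. LINT z|(lborel \<Otimes>\<^sub>M lborel). h z (u, v, s))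
        = (LINT u|lborel. LINT s|lborel. g (u, v, s) * exp (2 * pi * \<i> * lam * s)
            * exp (pi * \<i> * lam * u * (2 * \<eta> - v)) * ?K)"
      unfolding inner fst_conv snd_conv by (simp only: mult.assoc)
    also have "\<dots> = (LINT u|lborel. central_ft lam g u v * exp (pi * \<i> * lam * u * (2 * \<eta> - v))) * ?K"
      by (simp only: integral_mult_left_zero central_ft_def)
    \<comment> \<open>The kernel arguments \<open>\<eta> - v\<close> and \<open>\<eta>\<close> have
      difference \<open>v\<close> and sum \<open>2 * \<eta> - v\<close>.\<close>
    also have "(LINT u|lborel. central_ft lam g u v * exp (pi * \<i> * lam * u * (2 * \<eta> - v)))
        = weyl_kernel lam (central_ft lam g) (\<eta> - v) \<eta>"
      unfolding weyl_kernel_def by (simp add: algebra_simps)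
    finally show "(LINT u|lborel. LINT s|lborel. LINT z|(lborel \<Otimes>\<^sub>M lborel). h z (u, v, s))
        = weyl_kernel lam (central_ft lam g) (\<eta> - v) \<eta> * ?K" .
  qed
  finally show ?thesis .
qed

section \<open>The kernel of the first spline\<close>

text \<open>Factoring the phase at the midpoint \<open>c / 2\<close> out of the antiderivative
  leaves a difference of conjugate exponentials, hence a sine; frequency 0 is treated separately.
  The length \<open>c\<close> is left free because the support of the first spline has side 1 in
  \<open>t\<close> and side 2 in \<open>x\<close>.\<close>

lemma integral_exp_interval:
  fixes c w :: real
  assumes "0 \<le> c"
  shows "(LINT x|lborel. indicator {0..c} (x::real) * exp (2 * pi * \<i> * w * x))
    = c * exp (pi * \<i> * w * c) * nsinc (w * c)"
proof -
  have "(LINT x|lborel. indicator {0..c} (x::real) * exp (2 * pi * \<i> * w * x))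
      = (LINT x|lborel. indicator {0..c} (x::real) *\<^sub>R exp (2 * pi * \<i> * w * x))"
    by (intro Bochner_Integration.integral_cong) (auto simp: indicator_def)
  also have "\<dots> = c * exp (pi * \<i> * w * c) * nsinc (w * c)"
  proof (cases "w = 0")
    case True
    then show ?thesis using assms by (simp add: nsinc_def scaleR_conv_of_real)
  next
    case False
    define a :: complex where "a = 2 * pi * \<i> * w"
    have a: "a \<noteq> 0" using False by (simp add: a_def)
    have "(LINT x|lborel. indicator {0..c} x *\<^sub>R exp (a * of_real x))
        = exp (a * of_real c) / a - exp (a * of_real 0) / a"
      using assms
    proof (rule integral_FTC_atLeastAtMost)
      show "((\<lambda>x. exp (a * of_real x) / a) has_vector_derivative exp (a * of_real x)) (at x within {0..c})" for x
        using a by (auto intro!: derivative_eq_intros has_vector_derivative_real_field)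
      show "continuous_on {0..c} (\<lambda>x. exp (a * of_real x))"
        by (intro continuous_intros)
    qed
    also have "\<dots> = exp (pi * \<i> * w * c) * (exp (\<i> * of_real (pi * w * c)) - exp (- (\<i> * of_real (pi * w * c)))) / a"
      by (simp add: a_def diff_divide_distrib right_diff_distrib exp_add[symmetric] algebra_simps)
    also have "\<dots> = exp (pi * \<i> * w * c) * (2 * \<i> * of_real (sin (pi * w * c))) / a"
      by (simp add: sin_of_real[symmetric] sin_exp_eq)
    also have "\<dots> = c * exp (pi * \<i> * w * c) * nsinc (w * c)"
      using False by (auto simp: a_def nsinc_def field_simps)
    finally show ?thesis by (simp add: a_def)
  qed
  finally show ?thesis .
qed

text \<open>The first spline is a product of indicators, so the kernel splits into an interval
  integral in \<open>t\<close> and one in \<open>x\<close>. The side 2 in \<open>x\<close> times the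
  normalisation \<open>1 / sqrt 2\<close> gives the factor \<open>sqrt 2\<close>.\<close>

lemma bspline_kernel_1:
  "bspline_kernel lam 1 \<xi> \<eta>
    = sqrt 2 * exp (pi * \<i> * lam) * nsinc lam * exp (pi * \<i> * lam * (\<xi> + \<eta>))
      * nsinc (lam * (\<xi> + \<eta>)) * indicator {0..1} (\<eta> - \<xi>)"
proof -
  have ft: "central_ft lam (bspline 1) x y
      = complex_of_real (1 / sqrt 2) * indicator {0..2} x * indicator {0..1} y * (exp (pi * \<i> * lam) * nsinc lam)" for x y :: real
  proof -
    have "central_ft lam (bspline 1) x y
        = (LINT t|lborel. complex_of_real (1 / sqrt 2) * indicator {0..2} x * indicator {0..1} y
            * (indicator {0..1::real} (t::real) * exp (2 * pi * \<i> * lam * t)))"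
      unfolding central_ft_def by (simp add: indicator_times mult_ac)
    also have "\<dots> = complex_of_real (1 / sqrt 2) * indicator {0..2} x * indicator {0..1} y
        * (exp (pi * \<i> * lam) * nsinc lam)"
      unfolding integral_mult_right_zero using integral_exp_interval[of 1 lam] by simp
    finally show ?thesis .
  qed
  have s: "2 * complex_of_real (1 / sqrt 2) = sqrt 2"
    by (metis of_real_mult of_real_numeral real_div_sqrt times_divide_eq_right mult.right_neutral zero_le_numeral)
  \<comment> \<open>The frequency is half of \<open>lam * (\<xi> + \<eta>)\<close>; on an interval
    of length 2 the argument of \<open>nsinc\<close> is then \<open>lam * (\<xi> + \<eta>)\<close>
    itself.\<close>
  have e: "exp (2 * pi * \<i> * of_real (lam * (\<xi> + \<eta>) / 2) * of_real x)
      = exp (pi * \<i> * lam * x * (\<xi> + \<eta>))" for x :: real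
    by (rule arg_cong[where f = exp]) (simp add: algebra_simps)
  have "bspline_kernel lam 1 \<xi> \<eta>
      = (LINT x|lborel. complex_of_real (1 / sqrt 2) * indicator {0..1} (\<eta> - \<xi>) * (exp (pi * \<i> * lam) * nsinc lam)
          * (indicator {0..2::real} (x::real) * exp (2 * pi * \<i> * of_real (lam * (\<xi> + \<eta>) / 2) * x)))"
    unfolding bspline_kernel_def weyl_kernel_def ft e by (simp add: mult_ac)
  also have "\<dots> = complex_of_real (1 / sqrt 2) * indicator {0..1} (\<eta> - \<xi>) * (exp (pi * \<i> * lam) * nsinc lam)
      * (2 * exp (pi * \<i> * lam * (\<xi> + \<eta>)) * nsinc (lam * (\<xi> + \<eta>)))"
  proof -
    have "lam * (\<xi> + \<eta>) / 2 * 2 = lam * (\<xi> + \<eta>)" by simp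
    moreover have "exp (pi * \<i> * of_real (lam * (\<xi> + \<eta>) / 2) * of_real 2) = exp (pi * \<i> * lam * (\<xi> + \<eta>))"
      by (rule arg_cong[where f = exp]) (simp add: algebra_simps)
    ultimately show ?thesis
      unfolding integral_mult_right_zero
      using integral_exp_interval[of 2 "lam * (\<xi> + \<eta>) / 2"] by (simp only: of_real_numeral)
  qed
  also have "\<dots> = (2 * complex_of_real (1 / sqrt 2)) * exp (pi * \<i> * lam) * nsinc lam * exp (pi * \<i> * lam * (\<xi> + \<eta>))
      * nsinc (lam * (\<xi> + \<eta>)) * indicator {0..1} (\<eta> - \<xi>)"
    by (simp only: mult_ac)
  finally show ?thesis unfolding s by (simp only: of_real_add)
qed

section \<open>The recursion for the spline kernels\<close>

text \<open>This provides the slice hypothesis of \<open>weyl_kernel_heis_conv\<close> for the left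
  factor in the spline recursion. Each convolution multiplies the bound by the \<open>L^1\<close>
  norm of the first spline.\<close>

lemma bspline_slice_bound:
  "\<exists>C<\<infinity>. \<forall>y. (\<integral>\<^sup>+x. \<integral>\<^sup>+t. norm (bspline n (x, y, t)) \<partial>lborel \<partial>lborel) \<le> C"
proof (induction n rule: bspline.induct)
  case 1
  then show ?case by (intro exI[of _ 0]) simp
next
  case 2
  \<comment> \<open>The factor \<open>1 / sqrt 2\<close> and the indicator in \<open>y\<close> are
    both at most 1; dropping them leaves the area 2 of the rectangle in \<open>x\<close> and
    \<open>t\<close>.\<close>
  have "(\<integral>\<^sup>+x. \<integral>\<^sup>+t. norm (bspline (Suc 0) (x, y, t)) \<partial>lborel \<partial>lborel)
      \<le> (\<integral>\<^sup>+x. \<integral>\<^sup>+t. indicator {0..2::real} x * indicator {0..1::real} t \<partial>lborel \<partial>lborel)" for y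
    by (intro nn_integral_mono) (auto simp: indicator_def norm_mult norm_divide)
  also have "(\<integral>\<^sup>+x. \<integral>\<^sup>+t. indicator {0..2::real} x * indicator {0..1::real} t \<partial>lborel \<partial>lborel) = (2::ennreal)"
    by (simp add: nn_integral_cmult)
  finally show ?case by (intro exI[of _ 2]) simp
next
  case (3 n)
  then obtain C where C: "C < \<infinity>" "\<And>y. (\<integral>\<^sup>+x. \<integral>\<^sup>+t. norm (bspline (Suc n) (x, y, t)) \<partial>lborel \<partial>lborel) \<le> C"
    by blast
  have "C * (\<integral>\<^sup>+q. norm (bspline (Suc 0) q) \<partial>lborel) < \<infinity>"
    using C(1) integrable_bspline[of "Suc 0"]
    by (simp add: integrable_iff_bounded ennreal_mult_less_top del: bspline.simps)
  moreover have "(\<integral>\<^sup>+x. \<integral>\<^sup>+t. norm (bspline (Suc (Suc n)) (x, y, t)) \<partial>lborel \<partial>lborel)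
      \<le> C * (\<integral>\<^sup>+q. norm (bspline (Suc 0) q) \<partial>lborel)" for y
    unfolding bspline.simps(3)
    by (rule slice_bound_heis_conv[OF integrable_bspline integrable_bspline C(2)])
  ultimately show ?case by blast
qed

lemma bspline_kernel_Suc_Suc:
  "bspline_kernel lam (Suc (Suc n)) \<xi> \<eta>
    = (LINT v|lborel. bspline_kernel lam 1 (\<eta> - v) \<eta> * bspline_kernel lam (Suc n) \<xi> (\<eta> - v))"
proof -
  obtain C where "C < \<infinity>" "\<And>y. (\<integral>\<^sup>+x. \<integral>\<^sup>+t. norm (bspline (Suc n) (x, y, t)) \<partial>lborel \<partial>lborel) \<le> C"
    using bspline_slice_bound[of "Suc n"] by blast
  then show ?thesis
    unfolding bspline_kernel_def bspline.simps(3) One_nat_def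
    by (intro weyl_kernel_heis_conv[OF integrable_bspline integrable_bspline])
qed

theorem proposition4p2:
  fixes lam :: real
  assumes "lam \<noteq> 0"
  shows
    "(\<forall>\<xi> \<eta>. bspline_kernel lam 1 \<xi> \<eta>
        = sqrt 2 * exp (pi * \<i> * lam) * nsinc lam * exp (pi * \<i> * lam * (\<xi> + \<eta>))
          * nsinc (lam * (\<xi> + \<eta>)) * indicator {0..1} (\<eta> - \<xi>)) \<and>
     (\<forall>n\<ge>2. \<forall>\<xi> \<eta>. bspline_kernel lam n \<xi> \<eta>
        = sqrt 2 * exp (pi * \<i> * lam) * nsinc lam * exp (2 * pi * \<i> * lam * \<eta>)
          * (LINT w:{0..1}|lborel. exp (- pi * \<i> * lam * w) * nsinc (lam * (2 * \<eta> - w))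
               * bspline_kernel lam (n - 1) \<xi> (\<eta> - w)))"
proof (intro conjI allI impI)
  fix n :: nat and \<xi> \<eta> :: real
  assume "n \<ge> 2"
  then obtain m where n: "n = Suc (Suc m)"
    by (metis add_2_eq_Suc le_Suc_ex)
  define A :: complex where "A = sqrt 2 * exp (pi * \<i> * lam) * nsinc lam * exp (2 * pi * \<i> * lam * \<eta>)"
  define k where "k = (\<lambda>w. exp (- pi * \<i> * lam * w) * nsinc (lam * (2 * \<eta> - w))
      * bspline_kernel lam (Suc m) \<xi> (\<eta> - w))"
  \<comment> \<open>In the kernel of the first spline at \<open>\<eta> - w\<close> and
    \<open>\<eta>\<close>, the indicator is evaluated at the difference \<open>w\<close> and so
    restricts the integral to \<open>{0..1}\<close>. The sum \<open>2 * \<eta> - w\<close> splits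
    the phase into a part in \<open>\<eta>\<close>, absorbed by \<open>A\<close>, and a part in
    \<open>w\<close>.\<close>
  have "bspline_kernel lam 1 (\<eta> - w) \<eta> * bspline_kernel lam (Suc m) \<xi> (\<eta> - w)
      = A * (indicator {0..1} w *\<^sub>R k w)" for w
  proof -
    have "exp (pi * \<i> * lam * ((\<eta> - w) + \<eta>)) = exp (2 * pi * \<i> * lam * \<eta>) * exp (- pi * \<i> * lam * w)"
      by (simp add: exp_add[symmetric] algebra_simps)
    moreover have "(\<eta> - w) + \<eta> = 2 * \<eta> - w" by simp
    ultimately show ?thesis
      unfolding bspline_kernel_1 by (simp add: A_def k_def indicator_def)
  qed
  then have "bspline_kernel lam n \<xi> \<eta> = A * (LINT w:{0..1}|lborel. k w)"
    unfolding n bspline_kernel_Suc_Suc set_lebesgue_integral_def by (simp only: integral_mult_right_zero)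
  then show "bspline_kernel lam n \<xi> \<eta>
        = sqrt 2 * exp (pi * \<i> * lam) * nsinc lam * exp (2 * pi * \<i> * lam * \<eta>)
          * (LINT w:{0..1}|lborel. exp (- pi * \<i> * lam * w) * nsinc (lam * (2 * \<eta> - w))
               * bspline_kernel lam (n - 1) \<xi> (\<eta> - w))"
    by (simp add: A_def k_def n)
qed (rule bspline_kernel_1)

end
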